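(* Let $D$ be a strongly $2$-connected and neighborhood-cyclic digraph with $n\geq 9$ vertices and $m$ arcs. Then $$m\geq \frac{8}{3}n.$$
   Context: Digraphs are finite, without loops and without parallel arcs (two arcs of opposite orientation between the same pair of vertices are allowed; such a pair forms a directed cycle of length $2$). A digraph is cyclic if it contains a directed cycle (directed cycles of length $2$ count), and acyclic otherwise. A set $U$ of vertices of a digraph $D$ is cyclic (in $D$) if the subdigraph $D[U]$ of $D$ induced by $U$ is cyclic. For a vertex $u$ of $D$, $N^+_D(u)$ denotes the out-neighborhood of $u$ (the set of vertices $v$ such that $(u,v)$ is an arc of $D$) and $N^-_D(u)$ denotes the in-neighborhood of $u$ (the set of vertices $v$ such that $(v,u)$ is an arc of $D$). A digraph $D$ is neighborhood-cyclic if, for every vertex $u$ of $D$, both $N^+_D(u)$ and $N^-_D(u)$ are cyclic in $D$. A digraph $D$ is strongly $2$-connected if it has at least $3$ vertices, is strongly connected, and $D-v$ is strongly connected for every vertex $v$ of $D$. *)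

theory Defs
  imports Complex_Main "Graph_Theory.Digraph_Component"
begin

text \<open>
  Digraphs are taken from the library: the locale \<^locale>\<open>digraph\<close> requires a finite digraph without
  loops and without parallel arcs. It allows opposite arcs between two vertices, and such a pair
  of arcs forms a cycle of length 2 in the sense of \<^const>\<open>pre_digraph.cycle\<close>.
\<close>

definition cyclic_digraph :: "('a, 'b) pre_digraph \<Rightarrow> bool" where
  "cyclic_digraph D \<longleftrightarrow> (\<exists>p. pre_digraph.cycle D p)"

definition cyclic_in :: "('a, 'b) pre_digraph \<Rightarrow> 'a set \<Rightarrow> bool" where
  "cyclic_in D U \<longleftrightarrow> cyclic_digraph (D \<restriction> U)"

definition out_neighborhood :: "('a, 'b) pre_digraph \<Rightarrow> 'a \<Rightarrow> 'a set" where
  "out_neighborhood D u = {v. u \<rightarrow>\<^bsub>D\<^esub> v}"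

definition in_neighborhood :: "('a, 'b) pre_digraph \<Rightarrow> 'a \<Rightarrow> 'a set" where
  "in_neighborhood D u = {v. v \<rightarrow>\<^bsub>D\<^esub> u}"

definition neighborhood_cyclic :: "('a, 'b) pre_digraph \<Rightarrow> bool" where
  "neighborhood_cyclic D \<longleftrightarrow>
     (\<forall>u \<in> verts D. cyclic_in D (out_neighborhood D u) \<and> cyclic_in D (in_neighborhood D u))"

definition strongly_2_connected :: "('a, 'b) pre_digraph \<Rightarrow> bool" where
  "strongly_2_connected D \<longleftrightarrow>
     card (verts D) \<ge> 3 \<and> strongly_connected D \<and>
     (\<forall>v \<in> verts D. strongly_connected (pre_digraph.del_vert D v))"

end

theory Submission
  imports Defs
begin

text \<open>
  Induction on \<open>n\<close> shows \<open>3m \<ge> min (8n) (9n - 9)\<close> for all \<open>n \<ge> 3\<close>.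

  Suppose \<open>p\<close> has exactly two out-neighbours \<open>h\<close>, \<open>x\<close>, and \<open>h \<rightarrow> p\<close>. Then \<open>p\<close> can usually be deleted: each other
  in-neighbour of \<open>p\<close> gets one new arc (to \<open>x\<close>, \<open>h\<close> or another in-neighbour of \<open>p\<close>), and at least three
  arcs are lost. An uncrossing argument shows that some rerouting keeps the digraph strongly 2-connected.

  If no reduction applies, give each vertex the charge \<open>3 (d\<^sup>+ + d\<^sup>-) - 16\<close>. A complete digraph on three
  vertices has \<open>3\<cdot>3 - 3\<close> arcs, hence every set \<open>K\<close> that is connected by such triples spans at least
  \<open>3|K| - 3\<close> arcs. Either \<open>m \<ge> 3n - 3\<close>, or at least two arcs leave \<open>K\<close>, at least two enter it, and
  each one beyond these contributes three to its charge. A vertex outside these clusters with \<open>d\<^sup>+ + d\<^sup>- \<le> 5\<close> has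
  negative charge and is paid along its arcs by neighbours. A vertex outside the clusters with
  \<open>d\<^sup>+ + d\<^sup>- \<ge> 6\<close> pays along all but at least two of its out-arcs and all but at least two of its in-arcs,
  because its neighbourhoods are cyclic, and this it can afford.
\<close>

subsection \<open>Cyclic neighbourhoods\<close>

text \<open>For finite \<open>U\<close> this says that \<open>U\<close> contains a directed cycle.
  Demanding successors and predecessors at once makes the notion symmetric under
  \<open>converse\<close>, so every result can be applied to the reversed digraph.\<close>

definition cyc :: "('a \<times> 'a) set \<Rightarrow> 'a set \<Rightarrow> bool" where
  "cyc E U \<longleftrightarrow> (\<exists>W\<subseteq>U. W \<noteq> {} \<and> (\<forall>w\<in>W. \<exists>a\<in>W. (w, a) \<in> E) \<and> (\<forall>w\<in>W. \<exists>a\<in>W. (a, w) \<in> E))"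

definition digon :: "('a \<times> 'a) set \<Rightarrow> 'a \<Rightarrow> 'a \<Rightarrow> bool" where
  "digon E a b \<longleftrightarrow> (a, b) \<in> E \<and> (b, a) \<in> E"

lemma digon_sym: "digon E a b \<longleftrightarrow> digon E b a"
  by (auto simp: digon_def)

lemma cyc_converse [simp]: "cyc (E\<inverse>) U = cyc E U"
  by (simp only: cyc_def converse_iff) metis

lemma digon_converse [simp]: "digon (E\<inverse>) a b = digon E a b"
  by (auto simp: digon_def)

lemma cycE:
  assumes "cyc E U"
  obtains W where "W \<subseteq> U" "W \<noteq> {}" "\<And>w. w \<in> W \<Longrightarrow> \<exists>a\<in>W. (w, a) \<in> E"
    "\<And>w. w \<in> W \<Longrightarrow> \<exists>a\<in>W. (a, w) \<in> E"
  using assms unfolding cyc_def by metis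

text \<open>Vertices of \<open>W\<close> without a predecessor in \<open>W\<close> can be discarded:
  the successor of a kept vertex is itself kept, so the successor condition survives, and finiteness
  ends the process at a nonempty set.\<close>

lemma cycI:
  assumes "finite W" "W \<subseteq> U" "W \<noteq> {}" "\<And>w. w \<in> W \<Longrightarrow> \<exists>a\<in>W. (w, a) \<in> E"
  shows "cyc E U"
  using assms
proof (induction W rule: finite_psubset_induct)
  case (psubset W)
  define W' where "W' = {w \<in> W. \<exists>a\<in>W. (a, w) \<in> E}"
  show ?case
  proof (cases "W' = W")
    case True
    have "\<forall>w\<in>W. \<exists>a\<in>W. (a, w) \<in> E"
      using True unfolding W'_def by blast
    with psubset.prems show ?thesis unfolding cyc_def by metis
  next
    case False
    then have "W' \<subset> W" unfolding W'_def by blast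
    moreover have "W' \<noteq> {}"
      using psubset.prems(2,3) unfolding W'_def by blast
    moreover have "\<exists>a\<in>W'. (w, a) \<in> E" if "w \<in> W'" for w
      using that psubset.prems(3)[of w] unfolding W'_def by blast
    ultimately show ?thesis using psubset.IH psubset.prems(1) by blast
  qed
qed

lemma cyc_digon: "digon E a b \<Longrightarrow> a \<in> U \<Longrightarrow> b \<in> U \<Longrightarrow> cyc E U"
  unfolding cyc_def digon_def by (intro exI[of _ "{a, b}"]) auto

text \<open>\<open>cut\<close> is strong connectivity after deleting \<open>v\<close>, in terms of
  closed vertex sets. Connectivity arguments then consist in exhibiting a forbidden closed set, as
  in \<open>closed_del\<close>.\<close>

locale two_strong =
  fixes V :: "'a set" and E :: "('a \<times> 'a) set"
  assumes fin: "finite V"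
    and sub: "E \<subseteq> V \<times> V"
    and irr: "(v, v) \<notin> E"
    and out_cyc: "v \<in> V \<Longrightarrow> cyc E (E `` {v})"
    and in_cyc: "v \<in> V \<Longrightarrow> cyc E (E\<inverse> `` {v})"
    and cut: "\<lbrakk>v \<in> V; U \<subseteq> V - {v}; U \<noteq> {}; U \<noteq> V - {v}\<rbrakk> \<Longrightarrow> \<exists>a\<in>U. \<exists>b\<in>V - {v} - U. (a, b) \<in> E"

lemma two_strong_converse:
  assumes "two_strong V E"
  shows "two_strong V (E\<inverse>)"
proof -
  interpret two_strong V E by fact
  show ?thesis
  proof
    fix v U assume *: "v \<in> V" "U \<subseteq> V - {v}" "U \<noteq> {}" "U \<noteq> V - {v}"
    then obtain a b where "a \<in> V - {v} - U" "b \<in> V - {v} - (V - {v} - U)" "(a, b) \<in> E"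
      using cut[of v "V - {v} - U"] by blast
    with * show "\<exists>a\<in>U. \<exists>b\<in>V - {v} - U. (a, b) \<in> E\<inverse>" by blast
  qed (use fin sub irr out_cyc in_cyc in auto)
qed

context two_strong
begin

lemma fin_E: "finite E"
  using fin sub by (meson finite_SigmaI finite_subset)

lemma fin_out [simp]: "finite (E `` {v})" and fin_in [simp]: "finite (E\<inverse> `` {v})"
  using fin sub by (auto intro: finite_subset[OF _ fin])

lemma cyc_card:
  assumes "cyc E U" "finite U"
  shows "card U \<ge> 2"
proof -
  obtain W where W: "W \<subseteq> U" "W \<noteq> {}" "\<And>w. w \<in> W \<Longrightarrow> \<exists>a\<in>W. (w, a) \<in> E"
    using assms(1) by (rule cycE) blast
  obtain w a where "w \<in> W" "a \<in> W" "(w, a) \<in> E" using W by blast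
  then have "{w, a} \<subseteq> U" "w \<noteq> a" using W irr by auto
  then show ?thesis using card_mono[OF assms(2), of "{w, a}"] by simp
qed

lemma out_ge2: "v \<in> V \<Longrightarrow> card (E `` {v}) \<ge> 2" and in_ge2: "v \<in> V \<Longrightarrow> card (E\<inverse> `` {v}) \<ge> 2"
  using cyc_card out_cyc in_cyc by auto

lemma cyc_pair:
  assumes "cyc E {a, b}"
  shows "digon E a b"
proof -
  obtain W where W: "W \<subseteq> {a, b}" "W \<noteq> {}" "\<And>w. w \<in> W \<Longrightarrow> \<exists>a\<in>W. (w, a) \<in> E"
    using assms by (rule cycE) blast
  have "a \<in> W" "b \<in> W" using W irr by (metis empty_iff insert_iff subset_iff equals0I)+
  then show ?thesis using W irr unfolding digon_def by (metis empty_iff insert_iff subset_iff)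
qed

lemma out_two:
  assumes "v \<in> V" "card (E `` {v}) = 2"
  obtains a b where "E `` {v} = {a, b}" "a \<noteq> b" "digon E a b"
proof -
  obtain a b where ab: "E `` {v} = {a, b}" "a \<noteq> b" using assms(2) by (meson card_2_iff)
  with out_cyc[OF assms(1)] cyc_pair that show ?thesis by metis
qed

lemma closed_del:
  assumes "p \<in> V" "U \<subseteq> V - {p}" "u \<in> U" "w \<in> V - {p} - U"
    "\<And>a b. a \<in> U \<Longrightarrow> (a, b) \<in> E \<Longrightarrow> b \<noteq> p \<Longrightarrow> b \<in> U"
  shows False
  using cut[of p U] assms by blast

text \<open>Deleting \<open>p\<close> and rerouting its in-arcs, which loses at least three arcs: those between \<open>p\<close>
  and \<open>h\<close>, and \<open>(p, x)\<close>.\<close>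
lemma reduce:
  assumes p: "p \<in> V" and out: "E `` {p} = {h, x}" and hx: "h \<noteq> x" "digon E h x"
    and hp: "(h, p) \<in> E" and xp: "(x, p) \<notin> E"
    and Y: "Y = E\<inverse> `` {p} - {h}"
    and F: "F \<subseteq> Y \<times> (V - {p})" "\<And>v. (v, v) \<notin> F" "card (F - E) \<le> card Y"
    and E': "E' = E \<inter> (V - {p}) \<times> (V - {p}) \<union> F"
    and reach: "\<And>y v U. \<lbrakk>y \<in> Y; v \<in> V - {p}; v \<noteq> y; U \<subseteq> V - {p} - {v}; y \<in> U;
        \<And>a b. a \<in> U \<Longrightarrow> (a, b) \<in> E' \<Longrightarrow> b \<noteq> v \<Longrightarrow> b \<in> U\<rbrakk> \<Longrightarrow> {h, x} - {v} \<subseteq> U"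
    and outs: "\<And>y. y \<in> insert h Y \<Longrightarrow> cyc E' (E' `` {y})"
    and ins: "\<And>y. y \<in> {h, x} \<Longrightarrow> cyc E' (E'\<inverse> `` {y})"
  shows "two_strong (V - {p}) E'" "card E' + 3 \<le> card E"
proof -
  have ph: "(p, h) \<in> E" "(p, x) \<in> E" using out by auto
  have hV: "h \<in> V" "x \<in> V" "h \<noteq> p" "x \<noteq> p" using ph sub irr by auto
  have YV: "Y \<subseteq> V - {p}" using Y sub irr by auto
  show "two_strong (V - {p}) E'"
  proof
    show "finite (V - {p})" using fin by simp
    show "E' \<subseteq> (V - {p}) \<times> (V - {p})" using E' F YV by auto
    show "(v, v) \<notin> E'" for v using E' F irr by auto
  next
    fix v assume v: "v \<in> V - {p}"
    show "cyc E' (E' `` {v})"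
    proof (cases "v \<in> insert h Y")
      case False
      then have vp: "(v, p) \<notin> E" using Y by auto
      obtain W where W: "W \<subseteq> E `` {v}" "W \<noteq> {}" "\<And>w. w \<in> W \<Longrightarrow> \<exists>a\<in>W. (w, a) \<in> E"
        using out_cyc v by (metis DiffE cycE)
      have "p \<notin> W" using W(1) vp by auto
      then have "\<exists>a\<in>W. (w, a) \<in> E'" if "w \<in> W" for w
        using W(1) W(3)[OF that] that sub unfolding E' by blast
      moreover have "W \<subseteq> E' `` {v}" using W(1) vp v sub unfolding E' by auto
      moreover have "finite W" using W(1) finite_subset fin_out by blast
      ultimately show ?thesis using cycI W(2) by metis
    qed (use outs in auto)
    show "cyc E' (E'\<inverse> `` {v})"
    proof (cases "v \<in> {h, x}")
      case False
      then have vp: "(p, v) \<notin> E" using out by auto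
      obtain W where W: "W \<subseteq> E\<inverse> `` {v}" "W \<noteq> {}" "\<And>w. w \<in> W \<Longrightarrow> \<exists>a\<in>W. (w, a) \<in> E"
        using in_cyc v by (metis DiffE cycE)
      have "p \<notin> W" using W(1) vp by auto
      then have "\<exists>a\<in>W. (w, a) \<in> E'" if "w \<in> W" for w
        using W(1) W(3)[OF that] that sub unfolding E' by blast
      moreover have "W \<subseteq> E'\<inverse> `` {v}" using W(1) vp v sub unfolding E' by auto
      moreover have "finite W" using W(1) finite_subset fin_in by blast
      ultimately show ?thesis using cycI W(2) by metis
    qed (use ins in auto)
  next
    fix v U assume v: "v \<in> V - {p}" and U: "U \<subseteq> V - {p} - {v}" "U \<noteq> {}" "U \<noteq> V - {p} - {v}"
    show "\<exists>a\<in>U. \<exists>b\<in>V - {p} - {v} - U. (a, b) \<in> E'"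
    proof (rule ccontr)
      assume c: "\<not> ?thesis"
      have E'V: "E' \<subseteq> (V - {p}) \<times> (V - {p})" using E' F YV by auto
      have cl: "b \<in> U" if "a \<in> U" "(a, b) \<in> E'" "b \<noteq> v" for a b
        using that c E'V by auto
      have cl': "b \<in> U" if "a \<in> U" "(a, b) \<in> E" "b \<noteq> v" "b \<noteq> p" for a b
        using cl[of a b] that E' sub U by auto
      obtain w where w: "w \<in> V - {p} - {v} - U" using U by auto
      obtain u where u: "u \<in> U" using U by auto
      show False
      \<comment> \<open>If no arc leads from \<open>U\<close> to \<open>p\<close>, then
        \<open>U\<close> is already closed in the old digraph without \<open>v\<close>. Otherwise
        \<open>reach\<close> puts the out-neighbours of \<open>p\<close> other than \<open>v\<close>
        into \<open>U\<close>, and \<open>insert p U\<close> is closed there.\<close>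
      proof (cases "\<exists>y\<in>U. (y, p) \<in> E")
        case False
        then show False using closed_del[of v U u w] cl' v U u w by blast
      next
        case True
        then obtain y where y: "y \<in> U" "(y, p) \<in> E" by auto
        have "{h, x} - {v} \<subseteq> U"
        proof (cases "y = h")
          case True
          then show ?thesis using y cl'[of h x] hx(2) hV by (auto simp: digon_def)
        next
          case False
          then have "y \<in> Y" using Y y by auto
          then show ?thesis using reach[of y v U] v U y cl by auto
        qed
        then have "b \<in> insert p U" if "a \<in> insert p U" "(a, b) \<in> E" "b \<noteq> v" for a b
          using that cl' out by blast
        moreover have "insert p U \<subseteq> V - {v}" using U p v by auto
        ultimately show False using closed_del[of v "insert p U" u w] v u w by blast
      qed
    qed
  qed
  \<comment> \<open>The arcs in \<open>?C\<close> make up for the at most \<open>card Y\<close> new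
    arcs of \<open>F\<close>, so the three arcs of \<open>?B\<close> are a net loss.\<close>
  let ?A = "E \<inter> (V - {p}) \<times> (V - {p})"
  let ?B = "{(p, h), (p, x), (h, p)}"
  let ?C = "Y \<times> {p}"
  have "finite Y" using Y by simp
  have "?A \<union> ?B \<union> ?C \<subseteq> E" using ph hp Y by auto
  then have "card (?A \<union> ?B \<union> ?C) \<le> card E" using fin_E card_mono by blast
  moreover have "card (?A \<union> ?B \<union> ?C) = card ?A + card ?B + card ?C"
    using YV hV Y \<open>finite Y\<close> fin_E by (subst card_Un_disjoint; (subst card_Un_disjoint)?) auto
  moreover have "card ?B = 3" using hx hV by auto
  moreover have "card ?C = card Y" by (simp add: card_cartesian_product)
  moreover have "E' \<subseteq> ?A \<union> (F - E)" using E' F YV by auto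
  then have "card E' \<le> card ?A + card (F - E)"
    using card_mono[of "?A \<union> (F - E)" E'] card_Un_le[of ?A "F - E"] fin_E F(1) \<open>finite Y\<close> fin
    by (metis (no_types, lifting) finite_Diff finite_Int finite_SigmaI finite_UnI finite_subset le_trans)
  ultimately show "card E' + 3 \<le> card E" using F(3) by linarith
qed

end

subsection \<open>Irreducible digraphs\<close>

definition lone :: "('a \<times> 'a) set \<Rightarrow> 'a \<Rightarrow> bool" where
  "lone E v \<longleftrightarrow> \<not> (\<exists>a b. digon E v a \<and> digon E a b \<and> digon E b v)"

lemma lone_converse [simp]: "lone (E\<inverse>) v = lone E v"
  by (simp add: lone_def)

text \<open>Three arcs per deleted vertex is the price that the induction needs:
  \<open>min (8n) (9n - 9)\<close> grows by at most nine when \<open>n\<close> grows by one.\<close>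

locale no_reduction = two_strong V E for V :: "'a set" and E +
  assumes no_red: "\<And>(V' :: 'a set) E'. \<lbrakk>two_strong V' E'; card V' + 1 = card V; card E' + 3 \<le> card E\<rbrakk> \<Longrightarrow> False"

lemma no_reduction_converse:
  assumes "no_reduction V E"
  shows "no_reduction V (E\<inverse>)"
proof -
  interpret no_reduction V E by fact
  interpret r: two_strong V "E\<inverse>" by (rule two_strong_converse) unfold_locales
  show ?thesis
  proof
    fix V' :: "'a set" and E'
    assume "two_strong V' E'" "card V' + 1 = card V" "card E' + 3 \<le> card (E\<inverse>)"
    then show False using no_red[of V' "E'\<inverse>"] two_strong_converse[of V' E'] by simp
  qed
qed

context no_reduction
begin

text \<open>If the first rerouting of the in-arcs of \<open>p\<close> fails, it exposes an almost
  closed set \<open>U1\<close> and a vertex \<open>q\<close> without arcs to \<open>h\<close> and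
  \<open>x\<close>. If the other in-neighbour \<open>s\<close> had such an arc, a second rerouting
  would succeed. So \<open>s\<close> has none either, and the cycle among the in-neighbours of
  \<open>p\<close> can only be the digon of \<open>q\<close> and \<open>s\<close>.\<close>

lemma in_nbrs_of_digon:
  assumes p: "p \<in> V" "lone E p" and out: "E `` {p} = {h, x}" and hx: "h \<noteq> x" and ph: "digon E p h"
    and small: "card (E\<inverse> `` {p}) \<le> 3"
  obtains q s where "E\<inverse> `` {p} = {h, q, s}" "q \<noteq> h" "s \<noteq> h" "digon E q s"
    "(q, h) \<notin> E" "(q, x) \<notin> E" "(s, h) \<notin> E" "(s, x) \<notin> E"
proof -
  define Y where "Y = E\<inverse> `` {p} - {h}"
  define N where "N = {y \<in> Y. (y, h) \<notin> E \<and> (y, x) \<notin> E}"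
  have dhx: "digon E h x" using out_cyc[OF p(1)] cyc_pair unfolding out by blast
  have xp: "(x, p) \<notin> E" using p(2) dhx ph out unfolding lone_def digon_def by blast
  have hp: "(h, p) \<in> E" using ph by (simp add: digon_def)
  have inp: "E\<inverse> `` {p} = insert h Y" "h \<notin> Y" using hp Y_def by auto
  have finY: "finite Y" using Y_def by simp
  have cardY: "card Y \<le> 2" using small inp finY by simp
  have px: "(p, x) \<in> E" "(p, h) \<in> E" using out by auto
  have V: "h \<in> V" "x \<in> V" "h \<noteq> p" "x \<noteq> p" using px sub irr by auto
  have YV: "Y \<subseteq> V - {p}" "x \<notin> Y" using Y_def sub irr xp by auto
  have NY: "N \<subseteq> Y" by (auto simp: N_def)
  let ?A = "E \<inter> (V - {p}) \<times> (V - {p})"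
  have cardV: "card (V - {p}) + 1 = card V" using card_Suc_Diff1[OF fin p(1)] by (simp only: Suc_eq_plus1)

  \<comment> \<open>A cycle through \<open>p\<close> that avoids \<open>h\<close> continues to \<open>x\<close>, so it survives when its vertex before
    \<open>p\<close> is rerouted to \<open>x\<close>, possibly over one intermediate vertex.\<close>
  have keep: "cyc E' U'" if U: "cyc E U" "U - {p} \<subseteq> U'" "h \<notin> U" "finite U'" "U \<subseteq> V" "?A \<subseteq> E'"
    and re: "\<And>t. t \<in> U \<Longrightarrow> (t, p) \<in> E \<Longrightarrow> x \<in> U \<Longrightarrow> \<exists>z\<in>U'. (t, z) \<in> E' \<and> (z = x \<or> (z, x) \<in> E')"
    for U U' E'
  proof -
    obtain W where W: "W \<subseteq> U" "W \<noteq> {}" "\<And>w. w \<in> W \<Longrightarrow> \<exists>a\<in>W. (w, a) \<in> E"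
      using U(1) by (rule cycE) blast
    show ?thesis
    proof (cases "p \<in> W")
      case False
      then have "\<exists>a\<in>W. (w, a) \<in> E'" if "w \<in> W" for w
        using W(3)[OF that] U(5,6) W(1) that by blast
      moreover have "W \<subseteq> U'" using W(1) U(2) False by auto
      ultimately show ?thesis using cycI W(2) finite_subset U(4) by metis
    next
      case True
      then obtain a where a: "a \<in> W" "(p, a) \<in> E" using W(3) by blast
      then have "a \<in> {h, x}" using out by blast
      then have xW: "x \<in> W" using a W(1) U(3) by auto
      let ?W = "W - {p} \<union> {z \<in> U'. (z, x) \<in> E'}"
      have "\<exists>a\<in>?W. (w, a) \<in> E'" if w: "w \<in> ?W" for w
      proof (cases "(w, x) \<in> E'")
        case True
        then show ?thesis using xW V by auto
      next
        case False
        then have w: "w \<in> W" "w \<noteq> p" using w by auto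
        obtain a where a: "a \<in> W" "(w, a) \<in> E" using W(3) w by blast
        show ?thesis
        proof (cases "a = p")
          case True
          then show ?thesis using re[of w] a w W(1) xW V by blast
        next
          case False
          then show ?thesis using a w U(5,6) W(1) by blast
        qed
      qed
      moreover have "?W \<subseteq> U'" using W(1) U(2) by auto
      ultimately show ?thesis using cycI[of ?W U' E'] xW V U(4) finite_subset[of ?W U'] by blast
    qed
  qed

  \<comment> \<open>First rerouting: in-neighbours with an arc to \<open>h\<close> or
    \<open>x\<close> get both arcs, the others only the one to \<open>x\<close>.\<close>
  define FA where "FA = (Y - N) \<times> {h, x} \<union> N \<times> {x}"
  define EA where "EA = ?A \<union> FA"
  have FAx: "(y, x) \<in> EA" if "y \<in> Y" for y using that by (auto simp: EA_def FA_def)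
  have EA_V: "EA \<subseteq> (V - {p}) \<times> (V - {p})" using YV V NY by (auto simp: EA_def FA_def)
  then have finEA: "finite (EA `` {v})" "finite (EA\<inverse> `` {v})" for v
    using fin by (auto intro: finite_subset[of _ "V - {p}"])
  have hxA: "(h, x) \<in> EA" "(x, h) \<in> EA" using dhx V by (auto simp: EA_def digon_def)
  \<comment> \<open>The first rerouting can fail only through \<open>reach\<close> with
    \<open>v = x\<close> and a start in \<open>N\<close>; the set stated here is the witness of that
    failure.\<close>
  have A: "\<exists>y\<in>N. \<exists>U\<subseteq>V - {p, x}. y \<in> U \<and> h \<notin> U \<and> (\<forall>a\<in>U. \<forall>b. (a, b) \<in> EA \<longrightarrow> b \<noteq> x \<longrightarrow> b \<in> U)"
  proof (rule ccontr)
    assume neg: "\<not> ?thesis"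
    have card: "card (FA - E) \<le> card Y"
    proof -
      \<comment> \<open>A vertex of \<open>Y - N\<close> already has one of its two arcs, so each
        vertex of \<open>Y\<close> gets at most one new arc.\<close>
      let ?f = "\<lambda>y. (y, if (y, h) \<in> E then x else if (y, x) \<in> E then h else x)"
      have "FA - E \<subseteq> ?f ` Y" by (auto simp: FA_def N_def image_iff)
      then show ?thesis using finY by (meson card_image_le card_mono finite_imageI le_trans)
    qed
    have reach: "{h, x} - {v} \<subseteq> U" if "y \<in> Y" "v \<in> V - {p}" "v \<noteq> y" "U \<subseteq> V - {p} - {v}" "y \<in> U"
      and cl: "\<And>a b. a \<in> U \<Longrightarrow> (a, b) \<in> EA \<Longrightarrow> b \<noteq> v \<Longrightarrow> b \<in> U" for y v U
    proof (cases "v = x")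
      case False
      then have "x \<in> U" using cl FAx that by blast
      then show ?thesis using cl hxA by blast
    next
      case v: True
      have "h \<in> U"
      proof (cases "y \<in> N")
        case True
        have "U \<subseteq> V - {p, x}" using that(4) v by auto
        moreover have "\<forall>a\<in>U. \<forall>b. (a, b) \<in> EA \<longrightarrow> b \<noteq> x \<longrightarrow> b \<in> U" using cl v by simp
        ultimately show ?thesis using neg True that(5) by blast
      next
        case False
        then have "(y, h) \<in> EA" using that(1) by (auto simp: EA_def FA_def)
        then show ?thesis using cl[of y h] that(5) v hx by simp
      qed
      then show ?thesis using v by auto
    qed
    have outs: "cyc EA (EA `` {y})" if y: "y \<in> insert h Y" for y
    proof (cases "y \<in> Y - N")
      case True
      then have "h \<in> EA `` {y}" "x \<in> EA `` {y}" by (auto simp: EA_def FA_def)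
      then show ?thesis using cyc_digon hxA unfolding digon_def by metis
    next
      case False
      have yV: "y \<in> V - {p}" using y V YV by auto
      show ?thesis
      proof (rule keep[of "E `` {y}"])
        show "cyc E (E `` {y})" using out_cyc yV by auto
        show "E `` {y} - {p} \<subseteq> EA `` {y}" using yV sub by (auto simp: EA_def)
        show "h \<notin> E `` {y}" using y False irr by (auto simp: N_def)
        fix t assume t: "t \<in> E `` {y}" "(t, p) \<in> E" "x \<in> E `` {y}"
        then have "y = h" using y False by (auto simp: N_def)
        then have "t \<in> Y" using t irr by (auto simp: Y_def)
        then show "\<exists>z\<in>EA `` {y}. (t, z) \<in> EA \<and> (z = x \<or> (z, x) \<in> EA)"
          using FAx hxA \<open>y = h\<close> by blast
      qed (use finEA sub in \<open>auto simp: EA_def\<close>)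
    qed
    have ins: "cyc EA (EA\<inverse> `` {y})" if y: "y \<in> {h, x}" for y
    proof (cases "y = h")
      case True
      show ?thesis unfolding True
      proof (rule keep[of "E\<inverse> `` {h}"])
        show "E\<inverse> `` {h} - {p} \<subseteq> EA\<inverse> `` {h}" using V sub by (auto simp: EA_def)
        fix t assume t: "t \<in> E\<inverse> `` {h}" "(t, p) \<in> E"
        then have "t \<in> Y" using irr by (auto simp: Y_def)
        then show "\<exists>z\<in>EA\<inverse> `` {h}. (t, z) \<in> EA \<and> (z = x \<or> (z, x) \<in> EA)"
          using FAx hxA by blast
      qed (use finEA sub in_cyc V irr in \<open>auto simp: EA_def\<close>)
    next
      case False
      then have yx: "y = x" using y by auto
      \<comment> \<open>Every in-neighbour of \<open>p\<close> is an in-neighbour of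
        \<open>x\<close> after rerouting, so the cycle among the former also serves
        \<open>x\<close>.\<close>
      obtain W where W: "W \<subseteq> E\<inverse> `` {p}" "W \<noteq> {}" "\<And>w. w \<in> W \<Longrightarrow> \<exists>a\<in>W. (w, a) \<in> E"
        using in_cyc[OF p(1)] by (rule cycE) blast
      have WV: "W \<subseteq> V - {p}" using W(1) sub irr by auto
      have "\<exists>a\<in>W. (w, a) \<in> EA" if "w \<in> W" for w
        using W(3)[OF that] that WV by (auto simp: EA_def)
      moreover have "W \<subseteq> EA\<inverse> `` {x}" using W(1) FAx hxA unfolding inp by auto
      moreover have "finite W" using WV fin finite_subset by blast
      ultimately show ?thesis using cycI W(2) yx by metis
    qed
    have irrF: "(v, v) \<notin> FA" for v using inp(2) YV NY by (auto simp: FA_def)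
    have subF: "FA \<subseteq> Y \<times> (V - {p})" using V YV NY by (auto simp: FA_def)
    note red = reduce[OF p(1) out hx dhx hp xp Y_def subF irrF card EA_def reach outs ins]
    show False by (rule no_red[OF red(1) cardV red(2)])
  qed
  then obtain q U1 where q: "q \<in> N" and U1: "U1 \<subseteq> V - {p, x}" "q \<in> U1" "h \<notin> U1"
    and cl1: "\<And>a b. a \<in> U1 \<Longrightarrow> (a, b) \<in> EA \<Longrightarrow> b \<noteq> x \<Longrightarrow> b \<in> U1" by blast
  have disj: "(Y - N) \<inter> U1 = {}"
    using cl1 U1(3) hx by (auto simp: EA_def FA_def)
  obtain W where W: "W \<subseteq> insert h Y" "W \<noteq> {}" "\<And>w. w \<in> W \<Longrightarrow> \<exists>a\<in>W. (w, a) \<in> E"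
      "\<And>w. w \<in> W \<Longrightarrow> \<exists>a\<in>W. (a, w) \<in> E"
    using in_cyc[OF p(1)] unfolding inp by (rule cycE) blast
  have qY: "q \<in> Y" "(q, h) \<notin> E" "(q, x) \<notin> E" using q by (auto simp: N_def)
  have "\<exists>s. Y = {q, s} \<and> s \<noteq> q"
  proof -
    have "Y \<noteq> {q}"
    proof
      assume "Y = {q}"
      then have "W \<subseteq> {h, q}" using W(1) by auto
      then show False using W irr qY(2) by (metis empty_iff insert_iff subset_iff equals0I)
    qed
    then obtain s where s: "s \<in> Y" "s \<noteq> q" using qY by auto
    have "Y = {q, s}"
      by (rule sym, rule card_seteq[OF finY]) (use s qY cardY in auto)
    then show ?thesis using s by auto
  qed
  then obtain s where s: "Y = {q, s}" "s \<noteq> q" by auto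
  have sY: "s \<in> Y" using s by auto
  have sN: "s \<in> N"
  proof (rule ccontr)
    assume sN: "s \<notin> N"
    then have s1: "s \<notin> U1" using disj s by auto
    \<comment> \<open>The successor of \<open>q\<close> on the cycle could only be \<open>s\<close>,
      and closedness would pull \<open>s\<close> into \<open>U1\<close>.\<close>
    have "q \<notin> W"
    proof
      assume "q \<in> W"
      then obtain a where a: "a \<in> W" "(q, a) \<in> E" using W(3) by blast
      then have "a = s" using W(1) s qY(2) irr by auto
      then have "s \<in> U1" using cl1[of q s] a U1 YV s by (auto simp: EA_def)
      then show False using s1 by simp
    qed
    then have "W \<subseteq> {h, s}" using W(1) s by auto
    then have "cyc E {h, s}" using W unfolding cyc_def by metis
    then have hs: "digon E h s" by (rule cyc_pair)
    \<comment> \<open>Second rerouting: \<open>s\<close> already has its arc to \<open>h\<close>, so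
      only \<open>(s, x)\<close> and \<open>(q, s)\<close> can be new, one per element of
      \<open>Y\<close>.\<close>
    define FB where "FB = {(s, h), (s, x), (q, s)}"
    define EB where "EB = ?A \<union> FB"
    have sB: "(s, h) \<in> EB" "(s, x) \<in> EB" "(q, s) \<in> EB" "(h, s) \<in> EB"
      using hs V YV s by (auto simp: EB_def FB_def digon_def)
    have hxB: "(h, x) \<in> EB" "(x, h) \<in> EB" using dhx V by (auto simp: EB_def digon_def)
    have EB_V: "EB \<subseteq> (V - {p}) \<times> (V - {p})" using YV V s by (auto simp: EB_def FB_def)
    then have finEB: "finite (EB `` {v})" "finite (EB\<inverse> `` {v})" for v
      using fin by (auto intro: finite_subset[of _ "V - {p}"])
    have card: "card (FB - E) \<le> card Y"
    proof -
      have "FB - E \<subseteq> {(s, x), (q, s)}" using hs by (auto simp: FB_def digon_def)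
      then have "card (FB - E) \<le> card {(s, x), (q, s)}" by (intro card_mono) auto
      then show ?thesis using s by simp
    qed
    have reach: "{h, x} - {v} \<subseteq> U" if y: "y \<in> Y" and v: "v \<in> V - {p}" "v \<noteq> y"
      and U: "U \<subseteq> V - {p} - {v}" "y \<in> U"
      and cl: "\<And>a b. a \<in> U \<Longrightarrow> (a, b) \<in> EB \<Longrightarrow> b \<noteq> v \<Longrightarrow> b \<in> U" for y v U
    proof (cases "y = s \<or> v \<noteq> s")
      case True
      then have "s \<in> U" using cl[of q s] sB y U s by auto
      then show ?thesis using cl[of s h] cl[of s x] sB by auto
    next
      case False
      then have yq: "y = q" and vs: "v = s" using y s by auto
      \<comment> \<open>\<open>U1\<close> is left only towards \<open>p\<close> and \<open>x\<close>, and \<open>U\<close> only towards \<open>p\<close> and \<open>s\<close>.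
        If \<open>U\<close> misses \<open>h\<close> and \<open>x\<close>, then \<open>U1 \<inter> U\<close> is left only towards \<open>p\<close>.\<close>
      have "h \<in> U"
      proof (rule ccontr)
        assume hU: "h \<notin> U"
        have xs: "x \<noteq> s" "h \<noteq> s" using YV s inp by auto
        have xU: "x \<notin> U" using hU cl[of x h] hxB vs xs by auto
        have "b \<in> U1 \<inter> U" if ab: "a \<in> U1 \<inter> U" "(a, b) \<in> E" "b \<noteq> p" for a b
        proof -
          have A: "(a, b) \<in> ?A" using ab U1 sub by auto
          then have "b \<in> U \<or> b = s" using cl[of a b] ab vs by (auto simp: EB_def)
          moreover have "b \<in> U1 \<or> b = x" using cl1[of a b] ab A by (auto simp: EA_def)
          ultimately show ?thesis using xU s1 xs by auto
        qed
        then show False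
          using closed_del[of p "U1 \<inter> U" q h] p(1) U U1 yq V hU by blast
      qed
      then show ?thesis using cl[of h x] hxB by auto
    qed
    have outs: "cyc EB (EB `` {y})" if y: "y \<in> insert h Y" for y
    proof (cases "y = s")
      case True
      then have "h \<in> EB `` {y}" "x \<in> EB `` {y}" using sB by auto
      then show ?thesis using cyc_digon hxB unfolding digon_def by metis
    next
      case False
      then have y: "y = h \<or> y = q" using y s by auto
      have yV: "y \<in> V - {p}" using y V YV s by auto
      show ?thesis
      proof (rule keep[of "E `` {y}"])
        show "cyc E (E `` {y})" using out_cyc yV by auto
        show "E `` {y} - {p} \<subseteq> EB `` {y}" using yV sub by (auto simp: EB_def)
        show "h \<notin> E `` {y}" using y irr qY by auto
        fix t assume t: "t \<in> E `` {y}" "(t, p) \<in> E" "x \<in> E `` {y}"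
        then have "y = h" using y qY by auto
        then have "t \<in> Y" using t irr by (auto simp: Y_def)
        then have "t = s \<or> t = q" using s by auto
        then show "\<exists>z\<in>EB `` {y}. (t, z) \<in> EB \<and> (z = x \<or> (z, x) \<in> EB)"
          using sB hxB \<open>y = h\<close> by blast
      qed (use finEB sub in \<open>auto simp: EB_def\<close>)
    qed
    have ins: "cyc EB (EB\<inverse> `` {y})" if y: "y \<in> {h, x}" for y
    proof (cases "y = h")
      case True
      show ?thesis unfolding True
      proof (rule keep[of "E\<inverse> `` {h}"])
        show "E\<inverse> `` {h} - {p} \<subseteq> EB\<inverse> `` {h}" using V sub by (auto simp: EB_def)
        fix t assume t: "t \<in> E\<inverse> `` {h}" "(t, p) \<in> E"
        then have "t \<in> Y" "t \<noteq> q" using irr qY by (auto simp: Y_def)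
        then show "\<exists>z\<in>EB\<inverse> `` {h}. (t, z) \<in> EB \<and> (z = x \<or> (z, x) \<in> EB)"
          using sB hxB s by blast
      qed (use finEB sub in_cyc V irr in \<open>auto simp: EB_def\<close>)
    next
      case False
      then have "h \<in> EB\<inverse> `` {y}" "s \<in> EB\<inverse> `` {y}" using y sB hxB by auto
      then show ?thesis using cyc_digon sB unfolding digon_def by metis
    qed
    have irrF: "(v, v) \<notin> FB" for v using inp(2) YV s by (auto simp: FB_def)
    have subF: "FB \<subseteq> Y \<times> (V - {p})" using V YV s by (auto simp: FB_def)
    note red = reduce[OF p(1) out hx dhx hp xp Y_def subF irrF card EB_def reach outs ins]
    show False by (rule no_red[OF red(1) cardV red(2)])
  qed
  then have sn: "(s, h) \<notin> E" "(s, x) \<notin> E" by (auto simp: N_def)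
  have "h \<notin> W" using W(1,4) s sn qY irr by blast
  then have "W \<subseteq> {q, s}" using W(1) s by auto
  then have "cyc E {q, s}" using W unfolding cyc_def by metis
  then have "digon E q s" by (rule cyc_pair)
  then show ?thesis using that[of q s] inp s qY sn by auto
qed

end

subsection \<open>Charges\<close>

definition deg :: "('a \<times> 'a) set \<Rightarrow> 'a \<Rightarrow> nat" where
  "deg E v = card (E `` {v}) + card (E\<inverse> `` {v})"

definition low :: "('a \<times> 'a) set \<Rightarrow> 'a \<Rightarrow> bool" where
  "low E v \<longleftrightarrow> lone E v \<and> deg E v \<le> 5"

lemma deg_converse [simp]: "deg (E\<inverse>) v = deg E v"
  by (simp add: deg_def)

lemma low_converse [simp]: "low (E\<inverse>) v = low E v"
  by (simp add: low_def)

text \<open>An arc in \<open>pay E\<close> moves one unit of charge from its tail to its head. The transfers against the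
  direction of the arcs are those in \<open>pay (E\<inverse>)\<close>.\<close>

definition payer :: "('a \<times> 'a) set \<Rightarrow> 'a \<Rightarrow> 'a \<Rightarrow> bool" where
  "payer E p q \<longleftrightarrow> (q, p) \<in> E \<and> \<not> low E q \<and> (\<exists>s. (q, s) \<in> E \<and> (s, p) \<in> E) \<and> E `` {q} \<inter> E `` {p} = {}"

definition direct_pay :: "('a \<times> 'a) set \<Rightarrow> ('a \<times> 'a) set" where
  "direct_pay E = {(a, w) \<in> E. low E w \<and> card (E\<inverse> `` {w}) = 2 \<and> (\<forall>y. \<not> digon E w y)}"

text \<open>One unit suffices for such a \<open>p\<close>, so a single payer is selected. The
  disjointness in \<open>payer\<close> keeps \<open>p\<close> off every cycle among the
  out-neighbours of \<open>q\<close>, as \<open>out_slack\<close> needs; the intermediate vertex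
  \<open>s\<close> provides the detour of \<open>pay_from\<close>.\<close>

definition digon_pay :: "('a \<times> 'a) set \<Rightarrow> ('a \<times> 'a) set" where
  "digon_pay E = {(q, p). low E p \<and> card (E `` {p}) = 2 \<and> (\<exists>y. digon E p y) \<and> payer E p q
     \<and> q = (SOME q. payer E p q)}"

definition pay :: "('a \<times> 'a) set \<Rightarrow> ('a \<times> 'a) set" where
  "pay E = direct_pay E \<union> digon_pay E"

lemma pay_sub: "pay E \<subseteq> E"
  by (auto simp: pay_def direct_pay_def digon_pay_def payer_def)

lemma pay_low: "(a, w) \<in> pay E \<Longrightarrow> low E w"
  by (auto simp: pay_def direct_pay_def digon_pay_def)

section \<open>Who pays, and how much each vertex receives\<close>

context no_reduction
begin

lemma in_two:
  assumes "v \<in> V" "card (E\<inverse> `` {v}) = 2" "a \<in> E\<inverse> `` {v}"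
  obtains b where "E\<inverse> `` {v} = {a, b}" "a \<noteq> b" "digon E a b"
proof -
  interpret r: two_strong V "E\<inverse>" by (rule two_strong_converse) unfold_locales
  obtain x y where "E\<inverse> `` {v} = {x, y}" "x \<noteq> y" "digon E x y"
    using r.out_two[OF assms(1,2)] by auto
  then show ?thesis using that[of x] that[of y] assms(3) digon_sym[of E x y] by auto
qed

lemma low_digon_out:
  assumes p: "p \<in> V" "low E p" "card (E `` {p}) = 2" and h: "digon E p h"
  obtains x q s where "E `` {p} = {h, x}" "digon E h x" "E\<inverse> `` {p} = {h, q, s}" "q \<noteq> h" "s \<noteq> h"
    "digon E q s" "(q, h) \<notin> E" "(q, x) \<notin> E" "(s, h) \<notin> E" "(s, x) \<notin> E"
proof -
  obtain a b where ab: "E `` {p} = {a, b}" "a \<noteq> b" "digon E a b" using out_two p by metis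
  have "h \<in> E `` {p}" using h by (simp add: digon_def)
  then obtain x where x: "E `` {p} = {h, x}" "h \<noteq> x" "digon E h x"
    using ab digon_sym[of E a b] by auto
  have "card (E\<inverse> `` {p}) \<le> 3" "lone E p" using p by (auto simp: low_def deg_def)
  then show ?thesis using in_nbrs_of_digon[OF p(1) _ x(1,2) h] x that by metis
qed

lemma low_digon_in:
  assumes p: "p \<in> V" "low E p" "card (E\<inverse> `` {p}) = 2" and h: "digon E p h"
  obtains x q s where "E\<inverse> `` {p} = {h, x}" "digon E h x" "E `` {p} = {h, q, s}" "q \<noteq> h" "s \<noteq> h"
    "digon E q s" "(h, q) \<notin> E" "(x, q) \<notin> E" "(h, s) \<notin> E" "(x, s) \<notin> E"
proof -
  interpret r: no_reduction V "E\<inverse>" by (rule no_reduction_converse) unfold_locales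
  show ?thesis using r.low_digon_out[of p h] p h that by auto
qed

lemma low_cases:
  assumes "p \<in> V" "low E p"
  shows "card (E `` {p}) = 2 \<or> card (E\<inverse> `` {p}) = 2"
  using assms out_ge2[of p] in_ge2[of p] by (auto simp: low_def deg_def)

text \<open>Both \<open>q\<close> and \<open>s\<close> qualify unless they are low. If both are low,
  the cycle among the out-neighbours of \<open>q\<close> avoids \<open>p\<close>, which forces
  \<open>q\<close> to have out-degree three and in-degree two. The degree bound at \<open>s\<close>
  then identifies the remaining out-neighbour \<open>a\<close> of \<open>q\<close> with its
  remaining in-neighbour \<open>d\<close>, and \<open>q\<close>, \<open>s\<close>, \<open>a\<close>
  form a complete triple.\<close>

lemma payer_exists:
  assumes p: "p \<in> V" "low E p" "card (E `` {p}) = 2" and h: "digon E p h"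
  shows "\<exists>q. payer E p q"
proof -
  obtain x q s where out: "E `` {p} = {h, x}" and hx: "digon E h x" and inn: "E\<inverse> `` {p} = {h, q, s}"
    and ne: "q \<noteq> h" "s \<noteq> h" and qs: "digon E q s"
    and no: "(q, h) \<notin> E" "(q, x) \<notin> E" "(s, h) \<notin> E" "(s, x) \<notin> E"
    using low_digon_out[OF assms] by metis
  have to_p: "(q, p) \<in> E" "(s, p) \<in> E" using inn by auto
  show ?thesis
  proof (cases "low E q \<and> low E s")
    case False
    have "payer E p q" if "\<not> low E q" using that to_p qs no out by (auto simp: payer_def digon_def)
    moreover have "payer E p s" if "\<not> low E s" using that to_p qs no out by (auto simp: payer_def digon_def)
    ultimately show ?thesis using False by blast
  next
    case True
    have V: "q \<in> V" "s \<in> V" using to_p sub by auto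
    obtain W where W: "W \<subseteq> E `` {q}" "W \<noteq> {}" "\<And>w. w \<in> W \<Longrightarrow> \<exists>a\<in>W. (w, a) \<in> E"
      using out_cyc[OF V(1)] by (rule cycE) blast
    have pW: "p \<notin> W"
    proof
      assume "p \<in> W"
      then obtain a where "a \<in> W" "(p, a) \<in> E" using W(3) by blast
      then show False using W(1) out no by auto
    qed
    have finW: "finite W" using W(1) fin_out finite_subset by blast
    have "W \<subseteq> E `` {q} - {p}" using W(1) pW by auto
    then have cyc: "cyc E (E `` {q} - {p})" by (rule cycI[OF finW _ W(2,3)])
    then have "card (E `` {q} - {p}) \<ge> 2" using cyc_card by simp
    moreover have "card (E `` {q}) = Suc (card (E `` {q} - {p}))"
      using to_p fin_out by (metis Image_singleton_iff card.remove)
    ultimately have card: "card (E `` {q} - {p}) = 2" "card (E\<inverse> `` {q}) = 2"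
      using True in_ge2[OF V(1)] by (auto simp: low_def deg_def)
    have sp: "s \<noteq> p" "q \<noteq> p" using to_p irr by auto
    have "s \<in> E `` {q} - {p}" using qs sp by (auto simp: digon_def)
    moreover obtain y z where "E `` {q} - {p} = {y, z}" "y \<noteq> z" using card(1) by (meson card_2_iff)
    ultimately obtain a where a: "E `` {q} - {p} = {s, a}" "a \<noteq> s"
      by (cases "s = y") (auto simp: insert_commute)
    have sa: "digon E s a" using cyc unfolding a(1) by (rule cyc_pair)
    obtain d where d: "E\<inverse> `` {q} = {s, d}" "s \<noteq> d" "digon E s d"
      using in_two[OF V(1) card(2), of s] qs by (auto simp: digon_def)
    have "q \<noteq> x" using no hx by (auto simp: digon_def)
    then have "(p, q) \<notin> E" using out ne by auto
    moreover have dq: "(d, q) \<in> E" "(q, a) \<in> E" using a d by auto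
    ultimately have "d \<noteq> p" "d \<noteq> q" "a \<noteq> q" "a \<noteq> p" using irr a by auto
    moreover have "card (E `` {s}) \<le> 3"
      using True in_ge2[OF V(2)] by (auto simp: low_def deg_def)
    moreover have "{q, p, a, d} \<subseteq> E `` {s}" using qs to_p sa d(3) by (auto simp: digon_def)
    then have "card {q, p, a, d} \<le> card (E `` {s})" using card_mono fin_out by blast
    ultimately have "a = d" using sp by (auto simp: card_insert_if split: if_splits)
    then have "digon E q s \<and> digon E s a \<and> digon E a q" using qs sa dq by (auto simp: digon_def)
    then have "\<not> lone E q" unfolding lone_def by blast
    then show ?thesis using True by (simp add: low_def)
  qed
qed

text \<open>Low vertices never pay, and a paying arc has a detour of length two; the detour later
  yields a third arc leaving a cluster. For \<open>direct_pay\<close> the detour runs through the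
  other in-neighbour \<open>b\<close> of \<open>w\<close>. A low \<open>a\<close> would, by its
  digon with \<open>b\<close>, either give \<open>w\<close> a digon or exclude the arc from
  \<open>b\<close> to \<open>w\<close>.\<close>

lemma pay_from:
  assumes "(a, w) \<in> pay E"
  shows "\<not> low E a" "\<exists>b. (a, b) \<in> E \<and> (b, w) \<in> E"
proof -
  have "\<not> low E a \<and> (\<exists>b. (a, b) \<in> E \<and> (b, w) \<in> E)"
  proof (cases "(a, w) \<in> digon_pay E")
    case True
    then show ?thesis by (auto simp: digon_pay_def payer_def)
  next
    case False
    then have w: "(a, w) \<in> E" "low E w" "card (E\<inverse> `` {w}) = 2" "\<And>y. \<not> digon E w y"
      using assms by (auto simp: pay_def direct_pay_def)
    then have V: "a \<in> V" "w \<in> V" using sub by auto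
    obtain b where b: "E\<inverse> `` {w} = {a, b}" "a \<noteq> b" "digon E a b"
      using in_two[OF V(2) w(3), of a] w(1) by auto
    then have bw: "(b, w) \<in> E" "(a, b) \<in> E" by (auto simp: digon_def)
    have wb: "w \<noteq> b" using bw irr by auto
    have "\<not> low E a"
    proof
      assume low: "low E a"
      from low_cases[OF V(1) low] show False
      proof
        assume "card (E `` {a}) = 2"
        from low_digon_out[OF V(1) low this b(3)] obtain x where "E `` {a} = {b, x}" "digon E b x"
          by metis
        moreover have "w \<in> E `` {a}" using w(1) by simp
        ultimately have "digon E w b" using wb digon_sym[of E b x] by auto
        then show False using w(4) by blast
      next
        assume "card (E\<inverse> `` {a}) = 2"
        from low_digon_in[OF V(1) low this b(3)] obtain q s where
          "E `` {a} = {b, q, s}" "(b, q) \<notin> E" "(b, s) \<notin> E" by metis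
        moreover have "w \<in> E `` {a}" using w(1) by simp
        ultimately show False using wb bw by auto
      qed
    qed
    then show ?thesis using bw by blast
  qed
  then show "\<not> low E a" "\<exists>b. (a, b) \<in> E \<and> (b, w) \<in> E" by auto
qed

text \<open>On a cycle among the out-neighbours of \<open>v\<close>, a paid vertex \<open>w\<close>
  has no digon, while its predecessor forms a digon with \<open>v\<close>. Hence neither this
  predecessor nor the successor of \<open>w\<close> is paid, and they differ because
  \<open>w\<close> has no digon.\<close>

lemma out_slack:
  assumes v: "v \<in> V"
  shows "card (pay E `` {v}) + 2 \<le> card (E `` {v})"
proof -
  let ?P = "pay E `` {v}"
  obtain W where W: "W \<subseteq> E `` {v}" "W \<noteq> {}" "\<And>w. w \<in> W \<Longrightarrow> \<exists>a\<in>W. (w, a) \<in> E"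
      "\<And>w. w \<in> W \<Longrightarrow> \<exists>a\<in>W. (a, w) \<in> E"
    using out_cyc[OF v] by (rule cycE) blast
  have vW: "v \<notin> W" using W(1) irr by auto
  have dir: "(v, w) \<in> direct_pay E" if w: "w \<in> W" "w \<in> ?P" for w
  proof (rule ccontr)
    assume "\<not> ?thesis"
    then have "E `` {v} \<inter> E `` {w} = {}" using that by (auto simp: pay_def digon_pay_def payer_def)
    moreover obtain a where "a \<in> W" "(w, a) \<in> E" using W(3) w(1) by blast
    ultimately show False using W(1) by blast
  qed
  have pred: "digon E v a" if "w \<in> W" "w \<in> ?P" "a \<in> W" "(a, w) \<in> E" for a w
  proof -
    have w: "(v, w) \<in> E" "card (E\<inverse> `` {w}) = 2" "w \<in> V"
      using dir[OF that(1,2)] sub by (auto simp: direct_pay_def)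
    obtain b where "E\<inverse> `` {w} = {v, b}" "digon E v b" using in_two[OF w(3,2), of v] w(1) by auto
    then show ?thesis using that vW by auto
  qed
  have nod: "\<not> digon E w y" if "w \<in> W" "w \<in> ?P" for w y
    using dir[OF that] by (auto simp: direct_pay_def)
  have "\<exists>a b. a \<in> W - ?P \<and> b \<in> W - ?P \<and> a \<noteq> b"
  proof (cases "W \<inter> ?P = {}")
    case True
    obtain w a where "w \<in> W" "a \<in> W" "(w, a) \<in> E" using W(2,3) by blast
    then show ?thesis using irr True by (metis DiffI IntI empty_iff)
  next
    case False
    then obtain w where w: "w \<in> W" "w \<in> ?P" by auto
    obtain a b where a: "a \<in> W" "(a, w) \<in> E" and b: "b \<in> W" "(w, b) \<in> E" using W(3,4) w(1) by metis
    have "a \<notin> ?P" using pred[OF w a] nod[OF a(1)] digon_sym[of E v a] by blast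
    moreover have "b \<notin> ?P" using pred[OF b(1) _ w(1) b(2)] nod[OF w] digon_sym[of E v w] by blast
    moreover have "a \<noteq> b" using a b nod[OF w, of a] by (auto simp: digon_def)
    ultimately show ?thesis using a b by blast
  qed
  then obtain a b where ab: "a \<in> W - ?P" "b \<in> W - ?P" "a \<noteq> b" by blast
  have P: "?P \<subseteq> E `` {v}" using pay_sub by blast
  have "card (?P \<union> {a, b}) = card ?P + 2"
    using ab finite_subset[OF P] by (subst card_Un_disjoint) auto
  moreover have "?P \<union> {a, b} \<subseteq> E `` {v}" using P ab W(1) by auto
  ultimately show ?thesis using card_mono[OF fin_out] by metis
qed

text \<open>The deficit is four at degree 4 and one at degree 5. Without digons, each side of size
  two brings two units. With a digon the degree is 5, and one unit from the payer suffices.\<close>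

lemma received:
  assumes v: "v \<in> V" "low E v"
  shows "16 \<le> 3 * deg E v + card ((pay E)\<inverse> `` {v}) + card ((pay (E\<inverse>))\<inverse> `` {v})"
proof -
  have gen: "16 \<le> 3 * deg E v + card ((pay E)\<inverse> `` {v}) + card ((pay (E\<inverse>))\<inverse> `` {v})"
    if nr: "no_reduction V E" and h: "low E v" "digon E v h" "card (E `` {v}) = 2" for E h
  proof -
    interpret r: no_reduction V E by fact
    from r.payer_exists[OF v(1) h(1,3,2)] have "payer E v (SOME q. payer E v q)" by (rule someI_ex)
    then have "(SOME q. payer E v q) \<in> (pay E)\<inverse> `` {v}"
      using h by (auto simp: pay_def digon_pay_def)
    moreover have "finite ((pay E)\<inverse> `` {v})"
      using finite_subset[of "(pay E)\<inverse> `` {v}" "E\<inverse> `` {v}"] pay_sub r.fin_in by blast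
    ultimately have "card ((pay E)\<inverse> `` {v}) \<ge> 1" by (metis One_nat_def Suc_leI card_gt_0_iff empty_iff)
    moreover obtain x q s where "E\<inverse> `` {v} = {h, q, s}" "q \<noteq> h" "s \<noteq> h" "digon E q s"
      using r.low_digon_out[OF v(1) h(1,3,2)] by metis
    then have "card (E\<inverse> `` {v}) = 3" using r.irr by (auto simp: digon_def card_insert_if)
    ultimately show ?thesis using h(3) by (simp add: deg_def)
  qed
  have nr: "no_reduction V E" "no_reduction V (E\<inverse>)"
    using no_reduction_converse no_reduction_axioms by auto
  show ?thesis
  proof (cases "\<exists>y. digon E v y")
    case True
    then obtain h where "digon E v h" by blast
    then show ?thesis
      using low_cases[OF v] gen[OF nr(1), of h] gen[OF nr(2), of h] v(2) by auto
  next
    case False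
    have gen2: "card ((pay E)\<inverse> `` {v}) \<ge> 2"
      if "low E v" "\<And>y. \<not> digon E v y" "card (E\<inverse> `` {v}) = 2" for E :: "('a \<times> 'a) set"
    proof -
      have "E\<inverse> `` {v} \<subseteq> (pay E)\<inverse> `` {v}" using that by (auto simp: pay_def direct_pay_def)
      moreover have "(pay E)\<inverse> `` {v} \<subseteq> E\<inverse> `` {v}" using pay_sub by blast
      ultimately show ?thesis using that(3) by (metis subset_antisym order_refl)
    qed
    have "card (E\<inverse> `` {v}) = 2 \<Longrightarrow> card ((pay E)\<inverse> `` {v}) \<ge> 2" using gen2[of E] False v by blast
    moreover have "card (E `` {v}) = 2 \<Longrightarrow> card ((pay (E\<inverse>))\<inverse> `` {v}) \<ge> 2"
      using gen2[of "E\<inverse>"] False v by simp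
    ultimately show ?thesis using low_cases[OF v] out_ge2[OF v(1)] in_ge2[OF v(1)]
      unfolding deg_def by presburger
  qed
qed

end

subsection \<open>Clusters of complete triples\<close>

definition tri :: "('a \<times> 'a) set \<Rightarrow> ('a \<times> 'a) set" where
  "tri E = {(a, b). \<exists>c. digon E a b \<and> digon E b c \<and> digon E c a}"

text \<open>Since \<open>tri E\<close> is symmetric, clusters are equivalence classes; a lone vertex
  is a class of its own.\<close>

definition cluster :: "('a \<times> 'a) set \<Rightarrow> 'a \<Rightarrow> 'a set" where
  "cluster E v = (tri E)\<^sup>* `` {v}"

lemma tri_converse [simp]: "tri (E\<inverse>) = tri E"
  by (simp add: tri_def)

lemma cluster_converse [simp]: "cluster (E\<inverse>) v = cluster E v"
  by (simp add: cluster_def)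

lemma sym_tri: "sym (tri E)"
proof (rule symI)
  fix a b assume "(a, b) \<in> tri E"
  then obtain c where "digon E a b" "digon E b c" "digon E c a" by (auto simp: tri_def)
  then show "(b, a) \<in> tri E" unfolding tri_def digon_def by blast
qed

lemma lone_iff: "lone E v \<longleftrightarrow> v \<notin> Domain (tri E)"
  unfolding lone_def tri_def by auto

lemma cluster_self: "v \<in> cluster E v"
  by (simp add: cluster_def)

lemma cluster_eq:
  assumes "w \<in> cluster E v"
  shows "cluster E w = cluster E v"
proof -
  have "(v, w) \<in> (tri E)\<^sup>*" "(w, v) \<in> (tri E)\<^sup>*"
    using assms sym_rtrancl[OF sym_tri[of E]] by (auto simp: cluster_def dest: symD)
  then show ?thesis by (auto simp: cluster_def)
qed

lemma cluster_lone: "lone E v \<Longrightarrow> cluster E v = {v}"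
  unfolding cluster_def lone_iff by (auto elim: converse_rtranclE)

lemma cluster_not_lone:
  assumes "\<not> lone E v" "w \<in> cluster E v"
  shows "\<not> lone E w"
  using cluster_lone[of E w] cluster_eq[OF assms(2)] cluster_self[of v E] assms by auto

lemma sum_card_Image:
  assumes "finite K" "finite R"
  shows "(\<Sum>v\<in>K. card (R `` {v})) = card (R \<inter> K \<times> UNIV)"
proof -
  have "R \<inter> K \<times> UNIV = (SIGMA v:K. R `` {v})" by auto
  moreover have "finite (R `` {v})" for v using assms(2) by (rule finite_Image)
  ultimately show ?thesis using assms by (simp add: card_SigmaI)
qed

context two_strong
begin

lemma cluster_sub: "v \<in> V \<Longrightarrow> cluster E v \<subseteq> V"
proof
  fix w assume "v \<in> V" "w \<in> cluster E v"
  then have "(v, w) \<in> (tri E)\<^sup>*" by (simp add: cluster_def)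
  then show "w \<in> V" using \<open>v \<in> V\<close>
    by (induction) (use sub in \<open>auto simp: tri_def digon_def\<close>)
qed

lemma cluster_card3:
  assumes "v \<in> V" "\<not> lone E v"
  shows "card (cluster E v) \<ge> 3"
proof -
  obtain a b where ab: "digon E v a" "digon E a b" "digon E b v"
    using assms by (auto simp: lone_def)
  then have "(v, a) \<in> tri E" "(v, b) \<in> tri E" unfolding tri_def digon_def by blast+
  then have "{v, a, b} \<subseteq> cluster E v" by (auto simp: cluster_def)
  moreover have "card {v, a, b} = 3" using ab irr by (auto simp: digon_def card_insert_if)
  ultimately show ?thesis
    using card_mono[of "cluster E v" "{v, a, b}"] cluster_sub[OF assms(1)] fin finite_subset by metis
qed

text \<open>A complete triple adds to a set that it meets either one vertex and at least four arcs, or two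
  vertices and at least six arcs.\<close>
lemma cluster_arcs:
  assumes v: "v \<in> V"
  shows "3 * card (cluster E v) \<le> card (E \<inter> cluster E v \<times> cluster E v) + 3"
proof -
  let ?K = "cluster E v"
  have finK: "finite ?K" using cluster_sub[OF v] fin finite_subset by blast
  define P where "P S \<longleftrightarrow> v \<in> S \<and> S \<subseteq> ?K \<and> 3 * card S \<le> card (E \<inter> S \<times> S) + 3" for S
  have "P {v}" using cluster_self[of v E] by (simp add: P_def)
  moreover have "\<forall>S. P S \<longrightarrow> card S < Suc (card ?K)" using finK card_mono by (auto simp: P_def less_Suc_eq_le)
  \<comment> \<open>A largest set with the required density is taken. If it missed part of the
    cluster, a \<open>tri\<close> step leaving it would supply a triple that enlarges it.\<close>
  ultimately obtain S where S: "P S" and max: "\<And>S'. P S' \<Longrightarrow> card S' \<le> card S"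
    using ex_has_greatest_nat[of P "{v}" card "Suc (card ?K)"] by blast
  have finS: "finite S" using S finK finite_subset by (auto simp: P_def)
  have "?K \<subseteq> S"
  proof
    fix w assume "w \<in> ?K"
    then have "(v, w) \<in> (tri E)\<^sup>*" by (simp add: cluster_def)
    then show "w \<in> S"
    proof (induction)
      case base
      then show ?case using S by (simp add: P_def)
    next
      case (step a b)
      show ?case
      proof (rule ccontr)
        assume b: "b \<notin> S"
        obtain c where c: "digon E a b" "digon E b c" "digon E c a"
          using step(2) by (auto simp: tri_def)
        have ne: "a \<noteq> b" "b \<noteq> c" "c \<noteq> a" using c irr by (auto simp: digon_def)
        have "(a, c) \<in> tri E" using c unfolding tri_def digon_def by blast
        then have K: "b \<in> ?K" "c \<in> ?K"
          using step by (auto simp: cluster_def intro: rtrancl_into_rtrancl)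
        define S' where "S' = S \<union> {b, c}"
        have finS': "finite S'" using finS by (simp add: S'_def)
        have mono: "card (E \<inter> S \<times> S) + card A \<le> card (E \<inter> S' \<times> S')"
          if A: "A \<subseteq> E \<inter> S' \<times> S'" "A \<inter> S \<times> S = {}" for A
        proof -
          have fA: "finite A" using A(1) fin_E finite_subset by blast
          have "card (E \<inter> S \<times> S \<union> A) = card (E \<inter> S \<times> S) + card A"
            using A(2) fA fin_E by (intro card_Un_disjoint) auto
          moreover have "E \<inter> S \<times> S \<union> A \<subseteq> E \<inter> S' \<times> S'" using A(1) by (auto simp: S'_def)
          ultimately show ?thesis using card_mono[of "E \<inter> S' \<times> S'"] fin_E by (metis finite_Int)
        qed
        have "P S' \<and> card S' > card S"
        proof (cases "c \<in> S")
          case True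
          then have S': "S' = insert b S" by (auto simp: S'_def)
          let ?A = "{(a, b), (b, a), (b, c), (c, b)}"
          have "card (E \<inter> S \<times> S) + card ?A \<le> card (E \<inter> S' \<times> S')"
            by (rule mono) (use c b step True in \<open>auto simp: digon_def S'_def\<close>)
          moreover have "card ?A = 4" using ne by auto
          moreover have "card S' = card S + 1" using b finS by (simp add: S')
          ultimately show ?thesis using S K by (auto simp: P_def S')
        next
          case False
          let ?A = "{(a, b), (b, a), (b, c), (c, b), (a, c), (c, a)}"
          have "card (E \<inter> S \<times> S) + card ?A \<le> card (E \<inter> S' \<times> S')"
            by (rule mono) (use c b step False in \<open>auto simp: digon_def S'_def\<close>)
          moreover have "card ?A = 6" using ne by auto
          moreover have "card S' = card S + 2" using b finS False ne by (simp add: S'_def)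
          ultimately show ?thesis using S K by (auto simp: P_def S'_def)
        qed
        then show False using max[of S'] by linarith
      qed
    qed
  qed
  then have "S = ?K" using S by (auto simp: P_def)
  then show ?thesis using S by (simp add: P_def)
qed

section \<open>Arcs leaving a vertex set\<close>

lemma exits_tail:
  assumes K: "K \<subseteq> V" "card K \<ge> 2" "K \<noteq> V" and a: "a \<in> V"
  shows "\<exists>b w. (b, w) \<in> E \<inter> K \<times> (V - K) \<and> b \<noteq> a"
proof (cases "a \<in> K")
  case True
  have "K \<noteq> {a}" using K(2) by auto
  then have "\<exists>b\<in>K - {a}. \<exists>w\<in>V - {a} - (K - {a}). (b, w) \<in> E"
    using K a True by (intro cut) auto
  then show ?thesis using True by blast
next
  case False
  obtain y where y: "y \<in> K" using K(2) by fastforce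
  have "K \<noteq> {y}" using K(2) by auto
  then have "\<exists>b\<in>K - {y}. \<exists>w\<in>V - {y} - (K - {y}). (b, w) \<in> E"
    using K y by (intro cut) auto
  then show ?thesis using y False by blast
qed

lemma exits_head:
  assumes K: "K \<subseteq> V" "K \<noteq> {}" "card (V - K) \<ge> 2" and w: "w \<in> V - K"
  shows "\<exists>b u. (b, u) \<in> E \<inter> K \<times> (V - K) \<and> u \<noteq> w"
proof -
  have "V - K \<noteq> {w}" using K(3) by auto
  then have "\<exists>b\<in>K. \<exists>u\<in>V - {w} - K. (b, u) \<in> E" using K w by (intro cut) auto
  then show ?thesis by blast
qed

text \<open>Deleting the tail of one leaving arc produces a second with another tail. With a detour
  from \<open>a\<close> over \<open>b\<close> to \<open>w\<close>, two leaving arcs share the head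
  \<open>w\<close> or the tail \<open>a\<close>, depending on the side of \<open>b\<close>; a third
  has a different head or tail, respectively.\<close>

lemma exits:
  assumes K: "K \<subseteq> V" "card K \<ge> 2" "card (V - K) \<ge> 2"
  shows "card (E \<inter> K \<times> (V - K)) \<ge> 2"
    and "\<lbrakk>a \<in> K; w \<in> V - K; (a, w) \<in> E; (a, b) \<in> E; (b, w) \<in> E\<rbrakk> \<Longrightarrow> card (E \<inter> K \<times> (V - K)) \<ge> 3"
proof -
  let ?X = "E \<inter> K \<times> (V - K)"
  have ne: "K \<noteq> V" "K \<noteq> {}" using K(2,3) by auto
  have finX: "finite ?X" using fin_E by simp
  obtain y where "y \<in> K" using ne(2) by auto
  then obtain c u where cu: "(c, u) \<in> ?X" using exits_tail[OF K(1,2) ne(1), of y] K(1) by blast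
  then obtain c' u' where "(c', u') \<in> ?X" "c' \<noteq> c" using exits_tail[OF K(1,2) ne(1), of c] K(1) by blast
  then show "card ?X \<ge> 2" using cu card_mono[OF finX, of "{(c, u), (c', u')}"] by auto
  show "card ?X \<ge> 3" if aw: "a \<in> K" "w \<in> V - K" "(a, w) \<in> E" "(a, b) \<in> E" "(b, w) \<in> E"
  proof (cases "b \<in> K")
    case True
    obtain d u where "(d, u) \<in> ?X" "u \<noteq> w" using exits_head[OF K(1) ne(2) K(3) aw(2)] by blast
    moreover have "a \<noteq> b" using aw irr by auto
    ultimately show ?thesis
      using aw True card_mono[OF finX, of "{(a, w), (b, w), (d, u)}"] by auto
  next
    case False
    obtain d u where "(d, u) \<in> ?X" "d \<noteq> a" using exits_tail[OF K(1,2) ne(1), of a] aw(1) K(1) by blast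
    moreover have "w \<noteq> b" "b \<in> V" using aw irr sub by auto
    ultimately show ?thesis
      using aw False card_mono[OF finX, of "{(a, w), (a, b), (d, u)}"] by auto
  qed
qed

end

subsection \<open>The bound\<close>

lemma (in two_strong) sum_out: "(\<Sum>v\<in>V. card (E `` {v})) = card E"
proof -
  have "E \<inter> V \<times> UNIV = E" using sub by auto
  then show ?thesis using sum_card_Image[OF fin fin_E] by simp
qed

text \<open>A cluster that is all of \<open>V\<close> spans at least \<open>3n - 3\<close> arcs. A
  single outside vertex adds at least four arcs to the \<open>3(n - 1) - 3\<close> of the
  cluster.\<close>

lemma (in two_strong) cluster_complement:
  assumes v: "v \<in> V" and few: "card E + 3 < 3 * card V"
  shows "card (V - cluster E v) \<ge> 2"
proof (rule ccontr)
  let ?K = "cluster E v"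
  assume "\<not> ?thesis"
  then consider "card (V - ?K) = 0" | "card (V - ?K) = 1" by linarith
  then show False
  proof cases
    case 1
    then have "?K = V" using cluster_sub[OF v] fin by auto
    moreover have "E \<inter> V \<times> V = E" using sub by auto
    ultimately show False using cluster_arcs[OF v] few by simp
  next
    case 2
    then obtain y where y: "V - ?K = {y}" using card_1_singletonE by blast
    let ?A = "E \<inter> ?K \<times> ?K" and ?B = "E \<inter> {y} \<times> UNIV" and ?C = "E \<inter> UNIV \<times> {y}"
    have yV: "y \<in> V" "y \<notin> ?K" using y by auto
    have "?B = {y} \<times> E `` {y}" "?C = E\<inverse> `` {y} \<times> {y}" by auto
    then have BC: "card ?B \<ge> 2" "card ?C \<ge> 2"
      using out_ge2[OF yV(1)] in_ge2[OF yV(1)] by (auto simp: card_cartesian_product)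
    have "card (?A \<union> ?B \<union> ?C) = card ?A + card ?B + card ?C"
      using fin_E yV irr by (subst card_Un_disjoint; (subst card_Un_disjoint)?) auto
    moreover have "card (?A \<union> ?B \<union> ?C) \<le> card E" by (rule card_mono[OF fin_E]) auto
    moreover have "card V = card ?K + 1"
      using y cluster_sub[OF v] fin by (metis card_Diff_subset card_mono finite_subset 2 le_add_diff_inverse)
    ultimately show False using cluster_arcs[OF v] few BC by linarith
  qed
qed

context no_reduction
begin

text \<open>Paying arcs leave \<open>K\<close> because their heads are lone. Without any, the two
  leaving arcs account for the 6; otherwise there are at least three, and each keeps two of its
  three units.\<close>

lemma cluster_out:
  assumes v: "v \<in> V" "\<not> lone E v" and few: "card E + 3 < 3 * card V"
  defines "K \<equiv> cluster E v"
  shows "3 * card (E \<inter> K \<times> K) + 6 + (\<Sum>u\<in>K. card (pay E `` {u})) \<le> 3 * (\<Sum>u\<in>K. card (E `` {u}))"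
proof -
  have K: "K \<subseteq> V" "card K \<ge> 2" "card (V - K) \<ge> 2"
    using cluster_sub[OF v(1)] cluster_card3[OF v] cluster_complement[OF v(1) few] by (auto simp: K_def)
  have finK: "finite K" using K(1) fin finite_subset by blast
  have finP: "finite (pay E)" using pay_sub fin_E finite_subset by blast
  let ?X = "E \<inter> K \<times> (V - K)"
  have "E \<inter> K \<times> UNIV = E \<inter> K \<times> K \<union> ?X" using sub by auto
  moreover have "card (E \<inter> K \<times> K \<union> ?X) = card (E \<inter> K \<times> K) + card ?X"
    using fin_E by (intro card_Un_disjoint) auto
  ultimately have out: "(\<Sum>u\<in>K. card (E `` {u})) = card (E \<inter> K \<times> K) + card ?X"
    using sum_card_Image[OF finK fin_E] by simp
  let ?P = "pay E \<inter> K \<times> UNIV"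
  have P: "?P \<subseteq> ?X"
  proof
    fix e assume e: "e \<in> ?P"
    then obtain a w where aw: "e = (a, w)" "a \<in> K" "(a, w) \<in> pay E" by auto
    then have "lone E w" using pay_low low_def by metis
    then have "w \<notin> K" using cluster_not_lone[OF v(2)] by (auto simp: K_def)
    then show "e \<in> ?X" using aw pay_sub sub by auto
  qed
  have "card ?P + 6 \<le> 3 * card ?X"
  proof (cases "?P = {}")
    case True
    then show ?thesis using exits(1)[OF K] by (simp only: card.empty)
  next
    case False
    then obtain a w where aw: "(a, w) \<in> ?P" by auto
    then have X: "(a, w) \<in> ?X" using P by blast
    obtain b where "(a, b) \<in> E" "(b, w) \<in> E" using pay_from(2)[of a w] aw by auto
    then have "card ?X \<ge> 3" using exits(2)[OF K, of a w b] X by auto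
    moreover have "card ?P \<le> card ?X" using card_mono[OF _ P] fin_E by simp
    ultimately show ?thesis by linarith
  qed
  then show ?thesis using out sum_card_Image[OF finK finP] by linarith
qed

text \<open>The constants make the total equal to \<open>2(3m - 8n)\<close>, as transfers
  cancel.\<close>

definition charge :: "'a \<Rightarrow> int" where
  "charge v = 3 * int (deg E v) - 16
     - int (card (pay E `` {v})) - int (card (pay (E\<inverse>) `` {v}))
     + int (card ((pay E)\<inverse> `` {v})) + int (card ((pay (E\<inverse>))\<inverse> `` {v}))"

text \<open>A vertex that is not low pays at most \<open>deg - 4\<close>, which leaves
  \<open>2 deg - 12\<close>, nonnegative from degree 6 on.\<close>

lemma charge_lone:
  assumes "v \<in> V" "lone E v"
  shows "charge v \<ge> 0"
proof -
  interpret r: no_reduction V "E\<inverse>" by (rule no_reduction_converse) unfold_locales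
  show ?thesis
  proof (cases "low E v")
    case True
    then have "pay E `` {v} = {}" "pay (E\<inverse>) `` {v} = {}" using pay_from r.pay_from by auto
    then show ?thesis using received[OF assms(1) True] unfolding charge_def by auto
  next
    case False
    then have "deg E v \<ge> 6" using assms by (auto simp: low_def)
    moreover have "deg E v \<ge> card (pay E `` {v}) + card (pay (E\<inverse>) `` {v}) + 4"
      using out_slack[OF assms(1)] r.out_slack[OF assms(1)] by (simp add: deg_def)
    ultimately show ?thesis unfolding charge_def by linarith
  qed
qed

text \<open>With \<open>k\<close> vertices and \<open>i \<ge> 3k - 3\<close> inner arcs, both
  directions together retain \<open>6i + 12 \<ge> 18k - 6\<close>, which covers \<open>16k\<close>
  because \<open>k \<ge> 3\<close>.\<close>

lemma charge_cluster:
  assumes v: "v \<in> V" "\<not> lone E v" and few: "card E + 3 < 3 * card V"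
  shows "(\<Sum>u\<in>cluster E v. charge u) \<ge> 0"
proof -
  interpret r: no_reduction V "E\<inverse>" by (rule no_reduction_converse) unfold_locales
  let ?K = "cluster E v"
  let ?i = "card (E \<inter> ?K \<times> ?K)"
  have "E\<inverse> \<inter> ?K \<times> ?K = (E \<inter> ?K \<times> ?K)\<inverse>" by auto
  then have i: "card (E\<inverse> \<inter> ?K \<times> ?K) = ?i" by (metis card_inverse)
  have "3 * ?i + 6 + (\<Sum>u\<in>?K. card (pay (E\<inverse>) `` {u})) \<le> 3 * (\<Sum>u\<in>?K. card (E\<inverse> `` {u}))"
    using r.cluster_out[of v] v few i by simp
  moreover have "3 * ?i + 6 + (\<Sum>u\<in>?K. card (pay E `` {u})) \<le> 3 * (\<Sum>u\<in>?K. card (E `` {u}))"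
    by (rule cluster_out[OF v few])
  moreover have "3 * card ?K \<le> ?i + 3" "card ?K \<ge> 3"
    using cluster_arcs[OF v(1)] cluster_card3[OF v] by auto
  ultimately have "16 * card ?K + (\<Sum>u\<in>?K. card (pay E `` {u})) + (\<Sum>u\<in>?K. card (pay (E\<inverse>) `` {u}))
      \<le> 3 * (\<Sum>u\<in>?K. card (E `` {u})) + 3 * (\<Sum>u\<in>?K. card (E\<inverse> `` {u}))"
    by linarith
  then have "int (16 * card ?K + (\<Sum>u\<in>?K. card (pay E `` {u})) + (\<Sum>u\<in>?K. card (pay (E\<inverse>) `` {u})))
      \<le> int (3 * (\<Sum>u\<in>?K. card (E `` {u})) + 3 * (\<Sum>u\<in>?K. card (E\<inverse> `` {u})))"
    by (simp only: of_nat_le_iff)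
  then have "0 \<le> (\<Sum>u\<in>?K. 3 * int (deg E u) - 16 - int (card (pay E `` {u})) - int (card (pay (E\<inverse>) `` {u})))"
    by (simp add: deg_def sum_subtractf sum.distrib sum_distrib_left algebra_simps)
  also have "\<dots> \<le> (\<Sum>u\<in>?K. charge u)"
    by (intro sum_mono) (simp add: charge_def)
  finally show ?thesis .
qed

lemma sum_charge: "(\<Sum>v\<in>V. charge v) = 6 * int (card E) - 16 * int (card V)"
proof -
  interpret r: no_reduction V "E\<inverse>" by (rule no_reduction_converse) unfold_locales
  have deg: "(\<Sum>v\<in>V. deg E v) = 2 * card E"
    using sum_out r.sum_out by (simp add: deg_def sum.distrib)
  have bal: "(\<Sum>v\<in>V. card (R `` {v})) = (\<Sum>v\<in>V. card (R\<inverse> `` {v}))" if "R \<subseteq> V \<times> V" for R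
  proof -
    have "finite R" using that fin by (meson finite_SigmaI finite_subset)
    moreover have "R \<inter> V \<times> UNIV = R" "R\<inverse> \<inter> V \<times> UNIV = R\<inverse>" using that by auto
    ultimately show ?thesis using sum_card_Image[OF fin, of R] sum_card_Image[OF fin, of "R\<inverse>"] by simp
  qed
  have "pay E \<subseteq> V \<times> V" "pay (E\<inverse>) \<subseteq> V \<times> V" using pay_sub sub by blast+
  note b = this[THEN bal]
  have "(\<Sum>v\<in>V. charge v) = 3 * int (\<Sum>v\<in>V. deg E v) - 16 * int (card V)
     - int (\<Sum>v\<in>V. card (pay E `` {v})) - int (\<Sum>v\<in>V. card (pay (E\<inverse>) `` {v}))
     + int (\<Sum>v\<in>V. card ((pay E)\<inverse> `` {v})) + int (\<Sum>v\<in>V. card ((pay (E\<inverse>))\<inverse> `` {v}))"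
    unfolding charge_def by (simp add: sum_subtractf sum.distrib sum_distrib_left)
  then show ?thesis using b deg by simp
qed

lemma arcs_bound_irreducible:
  assumes few: "card E + 3 < 3 * card V"
  shows "8 * card V \<le> 3 * card E"
proof -
  have cls: "{u \<in> V. cluster E u = cluster E v} = cluster E v" if "v \<in> V" for v
  proof (intro set_eqI iffI)
    fix u assume "u \<in> {u \<in> V. cluster E u = cluster E v}"
    then show "u \<in> cluster E v" using cluster_self[of u E] by simp
  next
    fix u assume "u \<in> cluster E v"
    then show "u \<in> {u \<in> V. cluster E u = cluster E v}" using cluster_sub[OF that] cluster_eq[of u E v] by auto
  qed
  have nonneg: "(\<Sum>u\<in>cluster E v. charge u) \<ge> 0" if v: "v \<in> V" for v
  proof (cases "lone E v")
    case True
    then show ?thesis using charge_lone[OF v True] by (simp add: cluster_lone)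
  qed (use charge_cluster[OF v _ few] in auto)
  have "(\<Sum>v\<in>V. charge v) = (\<Sum>K\<in>cluster E ` V. \<Sum>u\<in>{u \<in> V. cluster E u = K}. charge u)"
    by (rule sum.group[symmetric]) (use fin in auto)
  moreover have "0 \<le> (\<Sum>u\<in>{u \<in> V. cluster E u = K}. charge u)" if K: "K \<in> cluster E ` V" for K
  proof -
    obtain v where "v \<in> V" "K = cluster E v" using K by auto
    then show ?thesis using cls[of v] nonneg[of v] by simp
  qed
  ultimately have "0 \<le> (\<Sum>v\<in>V. charge v)" by (simp only: sum_nonneg)
  then show ?thesis using sum_charge by linarith
qed

end

text \<open>For \<open>n \<le> 8\<close> wheels attain \<open>3n - 3\<close>, which is smaller than \<open>8n/3\<close>; the induction passes
  through these values of \<open>n\<close>.\<close>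
lemma arcs_bound:
  assumes "two_strong V E" "card V \<ge> 3"
  shows "min (8 * card V) (9 * card V - 9) \<le> 3 * card E"
  using assms
proof (induction "card V" arbitrary: V E rule: less_induct)
  case less
  interpret two_strong V E by fact
  show ?case
  proof (cases "card V = 3")
    case True
    have "2 * card V \<le> card E"
      using sum_mono[of V "\<lambda>_. 2" "\<lambda>v. card (E `` {v})"] out_ge2 sum_out by simp
    then show ?thesis using True by simp
  next
    case False
    then have n: "card V \<ge> 4" using less.prems by simp
    show ?thesis
    proof (cases "no_reduction V E")
      case True
      \<comment> \<open>If the hypothesis \<open>few\<close> fails, then
        \<open>3m \<ge> 9n - 9\<close> holds outright.\<close>
      then show ?thesis using no_reduction.arcs_bound_irreducible[OF True] by linarith
    next
      case False
      then obtain V' :: "'a set" and E' where *: "two_strong V' E'" "card V' + 1 = card V" "card E' + 3 \<le> card E"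
        unfolding no_reduction_def no_reduction_axioms_def using less.prems by blast
      then show ?thesis using less.hyps[of V' E'] n by linarith
    qed
  qed
qed

subsection \<open>Transfer to digraphs\<close>

lemma cyc_of_cyclic_in:
  assumes "digraph D" "cyclic_in D U"
  shows "cyc (arcs_ends D) U"
proof -
  interpret D: digraph D by fact
  interpret H: wf_digraph "D \<restriction> U" by (rule D.wellformed_induce_subgraph)
  obtain p u where p: "pre_digraph.awalk (D \<restriction> U) u p u" "p \<noteq> []"
    using assms(2) by (auto simp: cyclic_in_def cyclic_digraph_def pre_digraph.cycle_def)
  have arcs_p: "set p \<subseteq> arcs (D \<restriction> U)" and cas: "pre_digraph.cas (D \<restriction> U) u p u"
    using p(1) by (auto simp: pre_digraph.awalk_def)
  \<comment> \<open>The head of each arc of the closed walk is the tail of the next one, or the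
    starting vertex, which is also a tail. So the tails form a set with successors.\<close>
  have step: "head (D \<restriction> U) e \<in> tail (D \<restriction> U) ` set p \<union> {w}"
    if "pre_digraph.cas (D \<restriction> U) v p w" "e \<in> set p" for v w p e
    using that
  proof (induction p arbitrary: v)
    case (Cons a p)
    then show ?case by (cases p) (auto simp: pre_digraph.cas.simps)
  qed simp
  let ?W = "tail D ` set p"
  have "u \<in> ?W" using cas p(2) by (cases p) (auto simp: pre_digraph.cas.simps)
  then have "\<exists>a\<in>?W. (w, a) \<in> arcs_ends D" if "w \<in> ?W" for w
    using that step[OF cas] arcs_p by (fastforce simp: arcs_ends_def arc_to_ends_def)
  moreover have "?W \<subseteq> U" using arcs_p by auto
  ultimately show ?thesis using p(2) by (intro cycI[of ?W]) auto
qed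

lemma cut_of_strongly_connected:
  assumes "strongly_connected D" "U \<subseteq> verts D" "U \<noteq> {}" "U \<noteq> verts D"
  shows "\<exists>a\<in>U. \<exists>b\<in>verts D - U. (a, b) \<in> arcs_ends D"
proof -
  obtain a b where a: "a \<in> U" and b: "b \<in> verts D - U" using assms by auto
  have "(a, b) \<in> rtrancl_on (verts D) (arcs_ends D)"
    using assms(1,2) a b unfolding strongly_connected_def reachable_def by blast
  then have "b \<notin> U \<longrightarrow> ?thesis"
    by (induction rule: rtrancl_on_induct) (use a in auto)
  then show ?thesis using b by auto
qed

lemma two_strong_of_digraph:
  assumes "digraph D" "strongly_2_connected D" "neighborhood_cyclic D"
  shows "two_strong (verts D) (arcs_ends D)"
proof -
  interpret D: digraph D by fact
  have nb: "arcs_ends D `` {v} = out_neighborhood D v" "(arcs_ends D)\<inverse> `` {v} = in_neighborhood D v" for v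
    by (auto simp: out_neighborhood_def in_neighborhood_def)
  show ?thesis
  proof
    show "finite (verts D)" by simp
    show "arcs_ends D \<subseteq> verts D \<times> verts D" by (auto simp: arcs_ends_def arc_to_ends_def)
    show "(v, v) \<notin> arcs_ends D" for v
      using D.no_loops by (auto simp: arcs_ends_def arc_to_ends_def)
    fix v assume v: "v \<in> verts D"
    show "cyc (arcs_ends D) (arcs_ends D `` {v})"
      unfolding nb using cyc_of_cyclic_in[OF assms(1)] assms(3) v by (auto simp: neighborhood_cyclic_def)
    show "cyc (arcs_ends D) ((arcs_ends D)\<inverse> `` {v})"
      unfolding nb using cyc_of_cyclic_in[OF assms(1)] assms(3) v by (auto simp: neighborhood_cyclic_def)
    fix U assume U: "U \<subseteq> verts D - {v}" "U \<noteq> {}" "U \<noteq> verts D - {v}"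
    let ?H = "pre_digraph.del_vert D v"
    have "strongly_connected ?H" using assms(2) v by (simp add: strongly_2_connected_def)
    then have "\<exists>a\<in>U. \<exists>b\<in>verts ?H - U. (a, b) \<in> arcs_ends ?H"
      by (rule cut_of_strongly_connected) (use U in \<open>auto simp: D.verts_del_vert\<close>)
    moreover have "arcs_ends ?H \<subseteq> arcs_ends D"
      by (auto simp: arcs_ends_def arc_to_ends_def D.del_vert_simps)
    ultimately show "\<exists>a\<in>U. \<exists>b\<in>verts D - {v} - U. (a, b) \<in> arcs_ends D"
      unfolding D.verts_del_vert by blast
  qed
qed

theorem theorem3:
  fixes D :: "('a, 'b) pre_digraph" and n m :: nat
  assumes "digraph D"
    and "strongly_2_connected D"
    and "neighborhood_cyclic D"
    and "n = card (verts D)"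
    and "m = card (arcs D)"
    and "n \<ge> 9"
  shows "real m \<ge> 8 / 3 * real n"
proof -
  interpret D: digraph D by fact
  have "card (arcs_ends D) = m"
    using assms(5) by (simp add: arcs_ends_def card_image D.inj_on_arc_to_ends)
  then have "min (8 * n) (9 * n - 9) \<le> 3 * m"
    using arcs_bound[OF two_strong_of_digraph[OF assms(1-3)]] assms(4,6) by simp
  \<comment> \<open>From \<open>n = 9\<close> on, the minimum is \<open>8n\<close>.\<close>
  then have "8 * n \<le> 3 * m" using assms(6) by linarith
  then have "8 * real n \<le> 3 * real m" by (metis of_nat_le_iff of_nat_mult of_nat_numeral)
  then show ?thesis by simp
qed

end
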